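(* Let $d\ge2$, $k\in\{0,\dots,d-2\}$ and $\nu_{d-k}<0$. For the processes $\mu_a^{(d-k)}$, $a\ge1$, defined in the context, $$\mathbb E\,G_{d-k}(\mu_a^{(d-k)})\to0\quad\text{as }a\to\infty.$$
   Context: Let $b>0$, let $\chi:[0,b]^d\to[0,\infty)$ be bounded and measurable with $T=\int_{[0,b]^d}\chi(z)\,\mathrm dz>0$, let $e_1,\dots,e_d$ be the canonical unit vectors of $\mathbb R^d$, and let $Y=[0,b]^d\times\{2b\}\times\{e_1,\dots,e_d\}$. A point $y=(z,2b,e_i)\in Y$ is identified with the facet $\{s\in\mathbb R^d:\ s_i=z_i,\ \max_j|z_j-s_j|\le b\}$; $e_i$ is its orientation. The measure $\lambda$ on $Y$ is $\lambda(\mathrm d(z,r,\phi))=\chi(z)\,\mathrm dz\,\delta_{2b}(\mathrm dr)\,V(\mathrm d\phi)$ with $V$ uniform on $\{e_1,\dots,e_d\}$. For $a\ge1$, $\eta_a$ is the Poisson process on $Y$ with intensity measure $a\lambda$. For a finite configuration $\mathbf x$ of points of $Y$, $G_j(\mathbf x)=\frac1{j!}\sum\mathbb H^{d-j}(\bigcap_{i=1}^jx_i)$, the sum being over ordered $j$-tuples of distinct points of $\mathbf x$ whose hyperplanes are in general position (i.e. with pairwise different orientations); $\mathbb H^i$ is $i$-dimensional Hausdorff measure. $\mu_a^{(d-k)}$ is the point process with density $p_a(\mathbf x)=c_a\exp(\nu_{d-k}G_{d-k}(\mathbf x))$ with respect to the distribution of $\eta_a$, $c_a$ being the normalizing constant.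 *)

theory Defs
  imports "HOL-Probability.Probability"
begin

section \<open>Hausdorff measure\<close>

text \<open>
  The usual normalisation is used: \<open>hausdorff_measure m\<close> is the counting measure for \<open>m = 0\<close> and
  agrees with Lebesgue measure on \<open>m\<close>-dimensional planes. Empty covering sets cost nothing, also
  for \<open>m = 0\<close>; boundedness is required because \<^const>\<open>diameter\<close> is unspecified on unbounded sets.
\<close>

definition hausdorff_pre_measure :: "nat \<Rightarrow> real \<Rightarrow> 'a::metric_space set \<Rightarrow> ennreal" where
  "hausdorff_pre_measure m \<delta> A =
     (INF U \<in> {U :: nat \<Rightarrow> 'a set. A \<subseteq> (\<Union>i. U i) \<and> (\<forall>i. bounded (U i) \<and> diameter (U i) \<le> \<delta>)}.
        \<Sum>i. if U i = {} then 0 else ennreal (unit_ball_vol (real m) * (diameter (U i) / 2) ^ m))"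

definition hausdorff_measure :: "nat \<Rightarrow> 'a::metric_space set \<Rightarrow> ennreal" where
  "hausdorff_measure m A = (SUP \<delta> \<in> {0<..}. hausdorff_pre_measure m \<delta> A)"

section \<open>Finite point processes\<close>

text \<open>
  A configuration is a finite set of points, and a point process is represented by its distribution
  on the space of configurations. Points carry no multiplicities; this is no restriction for
  Poisson processes whose intensity measure is finite and has no atoms.
\<close>

definition config_space :: "'y measure \<Rightarrow> 'y set measure" where
  "config_space M =
     sigma {x. finite x \<and> x \<subseteq> space M}
       {{x. finite x \<and> x \<subseteq> space M \<and> card (x \<inter> B) = n} | B n. B \<in> sets M}"

text \<open>
  Meant for finite intensity measures \<open>\<Lambda>\<close>. The formula also covers \<open>measure \<Lambda> B = 0\<close>, where it says
  that there is almost surely no point in \<open>B\<close>.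
\<close>

definition poisson_process :: "'y measure \<Rightarrow> 'y set measure \<Rightarrow> bool" where
  "poisson_process \<Lambda> P \<longleftrightarrow>
     prob_space P \<and> sets P = sets (config_space \<Lambda>) \<and>
     (\<forall>B \<in> sets \<Lambda>. \<forall>n. measure P {x \<in> space P. card (x \<inter> B) = n} =
        measure \<Lambda> B ^ n / fact n * exp (- measure \<Lambda> B)) \<and>
     (\<forall>(B :: nat \<Rightarrow> 'y set) n. (\<forall>i<n. B i \<in> sets \<Lambda>) \<longrightarrow> disjoint_family_on B {..<n} \<longrightarrow>
        prob_space.indep_vars P (\<lambda>_. count_space UNIV) (\<lambda>i x. card (x \<inter> B i)) {..<n})"

section \<open>Facets\<close>

text \<open>A facet is encoded by its centre, its side length and its unit normal vector.\<close>

type_synonym 'd facet = "(real ^ 'd) \<times> real \<times> (real ^ 'd)"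

definition orientation :: "'d facet \<Rightarrow> real ^ 'd" where
  "orientation y = snd (snd y)"

text \<open>For \<open>r = 2 * b\<close> and \<open>\<phi> = axis i 1\<close> the conditions read \<open>s $ i = z $ i\<close> and \<open>\<bar>z $ j - s $ j\<bar> \<le> b\<close>.\<close>

definition facet_set :: "('d::finite) facet \<Rightarrow> (real ^ 'd) set" where
  "facet_set = (\<lambda>(z, r, \<phi>). {s. s \<bullet> \<phi> = z \<bullet> \<phi> \<and> (\<forall>j. \<bar>z $ j - s $ j\<bar> \<le> r / 2)})"

definition cube :: "real \<Rightarrow> (real ^ 'd::finite) set" where
  "cube b = cbox 0 (vec b)"

text \<open>The underlying space is \<open>cube b \<times> {2 * b} \<times> range (\<lambda>i. axis i 1)\<close>.\<close>

definition facet_intensity :: "real \<Rightarrow> (real ^ 'd \<Rightarrow> real) \<Rightarrow> ('d::finite) facet measure" where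
  "facet_intensity b chi =
     density (restrict_space lborel (cube b)) (\<lambda>z. ennreal (chi z)) \<Otimes>\<^sub>M
     (return (count_space {2 * b}) (2 * b) \<Otimes>\<^sub>M
      uniform_count_measure (range (\<lambda>i. axis i 1)))"

text \<open>
  The value \<open>enn2real\<close> loses nothing: facets with distinct orientations meet in a bounded subset
  of a plane of dimension \<open>CARD('d) - j\<close>, which has finite measure.
\<close>

definition G :: "nat \<Rightarrow> ('d::finite) facet set \<Rightarrow> real" where
  "G j x = 1 / fact j *
     (\<Sum>ys \<in> {ys. length ys = j \<and> distinct ys \<and> set ys \<subseteq> x \<and> distinct (map orientation ys)}.
        enn2real (hausdorff_measure (CARD('d) - j) (\<Inter>y\<in>set ys. facet_set y)))"

text \<open>The division by the integral is the normalising constant.\<close>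

definition gibbs_process :: "real \<Rightarrow> nat \<Rightarrow> ('d::finite) facet set measure \<Rightarrow> 'd facet set measure" where
  "gibbs_process \<nu> j P =
     density P (\<lambda>x. ennreal (exp (\<nu> * G j x)) / (\<integral>\<^sup>+ x'. ennreal (exp (\<nu> * G j x')) \<partial>P))"

end

theory Submission
  imports Defs "HOL-Real_Asymp.Real_Asymp"
begin

text \<open>
  Let \<open>j = d - k\<close>, \<open>q = d - j + 1 = k + 1\<close>, and let \<open>N\<^sub>I\<close> be the number of facets whose orientation
  belongs to \<open>I\<close>; under the Poisson process it has mean \<open>m |I|\<close> with \<open>m = a T / d\<close>. If no facet has
  one of \<open>q\<close> given orientations then \<open>G j = 0\<close>, so the normalising integral is at least \<open>exp (- q m)\<close>.
  In the numerator \<open>exp (\<nu> G) G\<close> is at most a constant times \<open>exp (\<nu> G / 2)\<close> and vanishes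
  unless \<open>j\<close> orientations occur. Fix a small \<open>\<epsilon> > 0\<close>. Either \<open>q + 1\<close> orientations have at most
  \<open>\<epsilon> m\<close> facets each, which has probability about \<open>exp (- (q + 1) m)\<close>, or there is a set \<open>A\<close> of
  \<open>j - 1\<close> orientations with more than \<open>\<epsilon> m\<close> facets each. Facets of different orientations always meet
  in a set of \<open>k\<close>-dimensional measure bounded below, so \<open>G\<close> is then at least a constant times \<open>m N\<^sub>B\<close>,
  where \<open>B\<close> is the complement of \<open>A\<close>, and \<open>N\<^sub>B \<ge> 1\<close>; the expectation of \<open>exp (- c m N\<^sub>B)\<close>
  on this event is \<open>exp (- q m) (exp (q m exp (- c m)) - 1)\<close>. Both contributions are \<open>o(exp (- q m))\<close>.
  Only the one-dimensional distributions of the Poisson process enter.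
\<close>

section \<open>Lower integrals of arbitrary functions\<close>

text \<open>
  For a nonmeasurable integrand, \<^const>\<open>nn_integral\<close> is the lower integral, and \<^const>\<open>density\<close>
  may be the zero measure. The inequalities below make it unnecessary to show that \<^const>\<open>G\<close> is measurable.
\<close>

lemma nn_integral_superadditive:
  fixes f g :: "'a \<Rightarrow> ennreal"
  shows "(\<integral>\<^sup>+x. f x \<partial>M) + (\<integral>\<^sup>+x. g x \<partial>M) \<le> (\<integral>\<^sup>+x. f x + g x \<partial>M)"
proof -
  let ?S = "\<lambda>h :: 'a \<Rightarrow> ennreal. {s. simple_function M s \<and> s \<le> h}"
  have ne: "?S h \<noteq> {}" for h
  proof -
    have "(\<lambda>_. 0) \<in> ?S h" by (auto simp: le_fun_def)
    then show ?thesis by blast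
  qed
  have add: "integral\<^sup>S M s + integral\<^sup>S M t \<le> (\<integral>\<^sup>+x. f x + g x \<partial>M)" if "s \<in> ?S f" "t \<in> ?S g" for s t
  proof -
    have "integral\<^sup>S M s + integral\<^sup>S M t = (\<integral>\<^sup>+x. s x + t x \<partial>M)"
      using that by (auto simp: nn_integral_eq_simple_integral[symmetric] nn_integral_add borel_measurable_simple_function)
    also have "\<dots> \<le> (\<integral>\<^sup>+x. f x + g x \<partial>M)"
      using that by (intro nn_integral_mono add_mono) (auto simp: le_fun_def)
    finally show ?thesis .
  qed
  have "integral\<^sup>S M s + (\<integral>\<^sup>+x. g x \<partial>M) \<le> (\<integral>\<^sup>+x. f x + g x \<partial>M)" if "s \<in> ?S f" for s
  proof -
    have "integral\<^sup>S M s + (\<integral>\<^sup>+x. g x \<partial>M) = (SUP t\<in>?S g. integral\<^sup>S M s + integral\<^sup>S M t)"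
      unfolding nn_integral_def[of M g] using ennreal_SUP_add_right[OF ne] by metis
    also have "\<dots> \<le> (\<integral>\<^sup>+x. f x + g x \<partial>M)" by (intro SUP_least add that)
    finally show ?thesis .
  qed
  moreover have "(\<integral>\<^sup>+x. f x \<partial>M) + (\<integral>\<^sup>+x. g x \<partial>M) = (SUP s\<in>?S f. integral\<^sup>S M s + (\<integral>\<^sup>+x. g x \<partial>M))"
    unfolding nn_integral_def[of M f] using ennreal_SUP_add_left[OF ne] by metis
  ultimately show ?thesis by (metis (no_types, lifting) SUP_least)
qed

lemma nn_integral_sum_le:
  fixes f :: "'i \<Rightarrow> 'a \<Rightarrow> ennreal"
  assumes "finite I"
  shows "(\<Sum>i\<in>I. \<integral>\<^sup>+x. f i x \<partial>M) \<le> (\<integral>\<^sup>+x. (\<Sum>i\<in>I. f i x) \<partial>M)"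
  using assms
proof induction
  case (insert i I)
  have "(\<Sum>i\<in>insert i I. \<integral>\<^sup>+x. f i x \<partial>M) \<le> (\<integral>\<^sup>+x. f i x \<partial>M) + (\<integral>\<^sup>+x. (\<Sum>i\<in>I. f i x) \<partial>M)"
    using insert by (simp add: add_left_mono)
  also have "\<dots> \<le> (\<integral>\<^sup>+x. (\<Sum>i\<in>insert i I. f i x) \<partial>M)"
    using insert by (simp add: nn_integral_superadditive)
  finally show ?case .
qed simp

lemma nn_integral_cmult_le:
  fixes f :: "'a \<Rightarrow> ennreal"
  shows "c * (\<integral>\<^sup>+x. f x \<partial>M) \<le> (\<integral>\<^sup>+x. c * f x \<partial>M)"
proof -
  have "c * integral\<^sup>S M s \<le> (\<integral>\<^sup>+x. c * f x \<partial>M)" if "simple_function M s" "s \<le> f" for s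
  proof -
    have "c * integral\<^sup>S M s = (\<integral>\<^sup>+x. c * s x \<partial>M)"
      using that by (simp add: nn_integral_eq_simple_integral[symmetric] nn_integral_cmult borel_measurable_simple_function)
    also have "\<dots> \<le> (\<integral>\<^sup>+x. c * f x \<partial>M)"
      using that by (intro nn_integral_mono mult_left_mono) (auto simp: le_fun_def)
    finally show ?thesis .
  qed
  then show ?thesis
    unfolding nn_integral_def[of M f] SUP_mult_left_ennreal by (auto intro!: SUP_least)
qed

text \<open>For an invertible factor the missing inequality is \<open>nn_integral_cmult_le\<close>
  applied to \<open>inverse c\<close>.\<close>

lemma nn_integral_cmult_finite:
  fixes f :: "'a \<Rightarrow> ennreal"
  assumes "c \<noteq> 0" "c \<noteq> \<infinity>"
  shows "(\<integral>\<^sup>+x. c * f x \<partial>M) = c * (\<integral>\<^sup>+x. f x \<partial>M)"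
proof (rule antisym)
  have inv: "inverse c * c = 1"
    using assms by (cases c) (auto simp: inverse_ennreal ennreal_eq_0_iff not_le less_imp_neq simp flip: ennreal_mult)
  have "(\<integral>\<^sup>+x. c * f x \<partial>M) = c * (inverse c * (\<integral>\<^sup>+x. c * f x \<partial>M))"
    using inv by (metis mult.assoc mult.commute mult_1)
  also have "\<dots> \<le> c * (\<integral>\<^sup>+x. inverse c * (c * f x) \<partial>M)"
    by (intro mult_left_mono nn_integral_cmult_le) simp
  also have "\<dots> = c * (\<integral>\<^sup>+x. f x \<partial>M)"
    using inv by (simp add: mult.assoc[symmetric])
  finally show "(\<integral>\<^sup>+x. c * f x \<partial>M) \<le> c * (\<integral>\<^sup>+x. f x \<partial>M)" .
qed (rule nn_integral_cmult_le)

text \<open>Either the integral over sets is a measure and equality holds on measurable sets, or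
  \<open>density\<close> falls back to the value 0.\<close>

lemma emeasure_density_le:
  "emeasure (density M f) A \<le> (\<integral>\<^sup>+x. f x * indicator A x \<partial>M)"
  unfolding density_def emeasure_measure_of_conv by simp

text \<open>A simple minorant of \<open>g\<close> is split into its level sets. On each of them
  \<open>emeasure_density_le\<close> applies, and superadditivity reassembles the pieces in the
  required direction.\<close>

lemma nn_integral_density_le:
  fixes f g :: "'a \<Rightarrow> ennreal"
  shows "(\<integral>\<^sup>+x. g x \<partial>density M f) \<le> (\<integral>\<^sup>+x. f x * g x \<partial>M)"
proof -
  have "integral\<^sup>S (density M f) s \<le> (\<integral>\<^sup>+x. f x * g x \<partial>M)"
    if s: "simple_function (density M f) s" "s \<le> g" for s
  proof -
    have fin: "finite (s ` space M)" using s by (simp add: simple_function_def)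
    have "integral\<^sup>S (density M f) s =
        (\<Sum>y\<in>s ` space M. y * emeasure (density M f) (s -` {y} \<inter> space M))"
      by (simp add: simple_integral_def)
    also have "\<dots> \<le> (\<Sum>y\<in>s ` space M. y * (\<integral>\<^sup>+x. f x * indicator (s -` {y} \<inter> space M) x \<partial>M))"
      by (intro sum_mono mult_left_mono emeasure_density_le) auto
    also have "\<dots> \<le> (\<Sum>y\<in>s ` space M. \<integral>\<^sup>+x. y * (f x * indicator (s -` {y} \<inter> space M) x) \<partial>M)"
      by (intro sum_mono nn_integral_cmult_le)
    also have "\<dots> \<le> (\<integral>\<^sup>+x. (\<Sum>y\<in>s ` space M. y * (f x * indicator (s -` {y} \<inter> space M) x)) \<partial>M)"
      by (intro nn_integral_sum_le fin)
    also have "\<dots> \<le> (\<integral>\<^sup>+x. f x * g x \<partial>M)"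
    proof (intro nn_integral_mono)
      fix x assume x: "x \<in> space M"
      have "(\<Sum>y\<in>s ` space M. y * (f x * indicator (s -` {y} \<inter> space M) x)) =
          (\<Sum>y\<in>s ` space M. if s x = y then y * f x else 0)"
        using x by (intro sum.cong) (auto simp: indicator_def)
      also have "\<dots> = s x * f x" using x fin by (simp add: sum.delta)
      also have "\<dots> \<le> f x * g x"
        using s by (metis le_funD mult.commute mult_left_mono zero_le)
      finally show "(\<Sum>y\<in>s ` space M. y * (f x * indicator (s -` {y} \<inter> space M) x)) \<le> f x * g x" .
    qed
    finally show ?thesis .
  qed
  then show ?thesis
    unfolding nn_integral_def[of "density M f" g] by (auto intro!: SUP_least)
qed

section \<open>Hausdorff measure of boxes\<close>

lemma hausdorff_measure_mono:
  assumes "A \<subseteq> B"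
  shows "hausdorff_measure m A \<le> hausdorff_measure m B"
  unfolding hausdorff_measure_def hausdorff_pre_measure_def
  by (intro SUP_mono' INF_superset_mono) (use assms in auto)

text \<open>Filling the directions outside \<open>I\<close> with unit intervals makes Lebesgue
  measure record only the extent in the directions of \<open>I\<close>.\<close>

lemma emeasure_cbox_slab:
  fixes p q :: "real ^ 'd::finite"
  assumes "\<And>i. i \<in> I \<Longrightarrow> q $ i = p $ i + h" "h \<ge> 0"
  shows "emeasure lborel (cbox (\<chi> i. if i \<in> I then p $ i else 0) (\<chi> i. if i \<in> I then q $ i else 1))
    = ennreal (h ^ card I)" (is "emeasure lborel (cbox ?a ?b) = _")
proof -
  have ne: "cbox ?a ?b \<noteq> {}"
    using assms by (auto simp: interval_ne_empty_cart)
  have "measure lborel (cbox ?a ?b) = (\<Prod>i\<in>UNIV. if i \<in> I then h else 1)"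
    using assms by (subst content_cbox_cart[OF ne]) (auto intro!: prod.cong)
  also have "\<dots> = h ^ card I" by (simp add: prod.If_cases)
  finally show ?thesis
    using emeasure_eq_ennreal_measure[of lborel "cbox ?a ?b"] emeasure_lborel_cbox_finite[of ?a ?b]
    by (simp add: less_top[symmetric])
qed

text \<open>The box is thickened by \<open>1\<close> in the degenerate directions, and each covering set is replaced by
  a box of the same thickness; comparing Lebesgue measures gives the bound.\<close>

lemma hausdorff_measure_cbox_ge:
  fixes p q :: "real ^ 'd::finite"
  assumes h: "h \<ge> 0" and I: "\<And>i. i \<in> I \<Longrightarrow> q $ i = p $ i + h" and nI: "\<And>i. i \<notin> I \<Longrightarrow> q $ i = p $ i"
  shows "ennreal (unit_ball_vol (card I) * (h / 4) ^ card I) \<le> hausdorff_measure (card I) (cbox p q)"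
proof -
  let ?w = "unit_ball_vol (card I)"
  have "ennreal (?w * (h / 4) ^ card I) \<le>
      (\<Sum>i. if U i = {} then 0 else ennreal (?w * (diameter (U i) / 2) ^ card I))"
    if U: "cbox p q \<subseteq> (\<Union>i. U i)" "\<And>i. bounded (U i)" for U :: "nat \<Rightarrow> (real ^ 'd) set"
  proof -
    define u where "u i = (SOME x. x \<in> U i)" for i
    have u: "u i \<in> U i" if "U i \<noteq> {}" for i using that unfolding u_def by (simp add: some_in_eq)
    define D where "D i = diameter (U i)" for i
    have D: "D i \<ge> 0" for i unfolding D_def by (rule diameter_ge_0[OF U(2)])
    \<comment> \<open>The cube of half side \<open>D i\<close> around any point of
      \<open>U i\<close> contains \<open>U i\<close>.\<close>
    define lo hi where "lo i = (\<chi> l. u i $ l - D i)" and "hi i = (\<chi> l. u i $ l + D i)" for i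
    define V where "V i = (if U i = {} then {} else
      cbox (\<chi> l. if l \<in> I then lo i $ l else 0) (\<chi> l. if l \<in> I then hi i $ l else 1))" for i
    have V: "emeasure lborel (V i) = (if U i = {} then 0 else ennreal ((2 * D i) ^ card I))" for i
      using emeasure_cbox_slab[of I "hi i" "lo i" "2 * D i"] D[of i] by (auto simp: V_def lo_def hi_def)
    have "cbox (\<chi> i. if i \<in> I then p $ i else 0) (\<chi> i. if i \<in> I then q $ i else 1) \<subseteq> (\<Union>i. V i)"
    proof
      fix s assume s: "s \<in> cbox (\<chi> i. if i \<in> I then p $ i else 0) (\<chi> i. if i \<in> I then q $ i else 1)"
      \<comment> \<open>Projecting \<open>s\<close> back onto the degenerate box gives a point that
        the cover catches; \<open>s\<close> agrees with it in the directions of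
        \<open>I\<close>.\<close>
      define s' where "s' = (\<chi> l. if l \<in> I then s $ l else p $ l)"
      have "s' \<in> cbox p q"
        unfolding mem_box_cart
      proof
        fix l
        show "p $ l \<le> s' $ l \<and> s' $ l \<le> q $ l"
          using s nI[of l] by (cases "l \<in> I") (auto simp: s'_def mem_box_cart dest!: spec[of _ l])
      qed
      then obtain i where i: "s' \<in> U i" using U by auto
      have d: "dist s' (u i) \<le> D i"
        unfolding D_def using i u[of i] by (intro diameter_bounded_bound U) auto
      have "\<bar>s $ l - u i $ l\<bar> \<le> D i" if "l \<in> I" for l
      proof -
        have "\<bar>(s' - u i) $ l\<bar> \<le> norm (s' - u i)" by (rule component_le_norm_cart)
        then show ?thesis using d that by (simp add: dist_norm s'_def)
      qed
      then have *: "lo i $ l \<le> s $ l \<and> s $ l \<le> hi i $ l" if "l \<in> I" for l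
        using that unfolding lo_def hi_def by (simp add: abs_le_iff) (smt (verit))
      have **: "0 \<le> s $ l \<and> s $ l \<le> 1" if "l \<notin> I" for l
        using s that by (auto simp: mem_box_cart dest!: spec[of _ l])
      have "s \<in> cbox (\<chi> l. if l \<in> I then lo i $ l else 0) (\<chi> l. if l \<in> I then hi i $ l else 1)"
        using * ** by (simp add: mem_box_cart)
      then have "s \<in> V i" using i by (auto simp: V_def)
      then show "s \<in> (\<Union>i. V i)" by blast
    qed
    then have sub: "cbox (\<chi> i. if i \<in> I then p $ i else 0) (\<chi> i. if i \<in> I then q $ i else 1) \<subseteq> (\<Union>i. V i)" .
    have Vm: "V i \<in> sets lborel" for i by (auto simp: V_def)
    have "ennreal (h ^ card I)
        = emeasure lborel (cbox (\<chi> i. if i \<in> I then p $ i else 0) (\<chi> i. if i \<in> I then q $ i else 1))"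
      by (rule emeasure_cbox_slab[OF I h, symmetric])
    also have "\<dots> \<le> emeasure lborel (\<Union>i. V i)"
      using Vm by (intro emeasure_mono sub) auto
    also have "\<dots> \<le> (\<Sum>i. emeasure lborel (V i))"
      using Vm by (intro emeasure_subadditive_countably) auto
    finally have le: "ennreal (h ^ card I) \<le> (\<Sum>i. if U i = {} then 0 else ennreal ((2 * D i) ^ card I))"
      by (simp add: V)
    \<comment> \<open>The replacement boxes have side \<open>2 * D i\<close>, whereas the Hausdorff
      cost uses \<open>D i / 2\<close>; this is the source of the factor 4.\<close>
    have "ennreal (?w * (h / 4) ^ card I) = ennreal (?w / 4 ^ card I) * ennreal (h ^ card I)"
      using h by (simp add: power_divide ennreal_mult[symmetric])
    also have "\<dots> \<le> ennreal (?w / 4 ^ card I) * (\<Sum>i. if U i = {} then 0 else ennreal ((2 * D i) ^ card I))"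
      by (intro mult_left_mono le) auto
    also have "\<dots> = (\<Sum>i. ennreal (?w / 4 ^ card I) * (if U i = {} then 0 else ennreal ((2 * D i) ^ card I)))"
      by (rule ennreal_suminf_cmult[symmetric])
    also have "\<dots> = (\<Sum>i. if U i = {} then 0 else ennreal (?w * (D i / 2) ^ card I))"
    proof (intro suminf_cong)
      fix i
      have "?w / 4 ^ card I * (2 * D i) ^ card I = ?w * (D i / 2) ^ card I"
      proof -
        have "(2 * D i) ^ card I = 4 ^ card I * (D i / 2) ^ card I"
          unfolding power_mult_distrib[symmetric] by simp
        then show ?thesis by simp
      qed
      then show "ennreal (?w / 4 ^ card I) * (if U i = {} then 0 else ennreal ((2 * D i) ^ card I)) =
          (if U i = {} then 0 else ennreal (?w * (D i / 2) ^ card I))"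
        using D[of i] by (simp add: ennreal_mult[symmetric])
    qed
    finally show ?thesis unfolding D_def .
  qed
  \<comment> \<open>The estimate holds for every cover by bounded sets, so any single mesh bounds
    the supremum over \<open>\<delta>\<close> from below.\<close>
  then have "ennreal (?w * (h / 4) ^ card I) \<le> hausdorff_pre_measure (card I) 1 (cbox p q)"
    unfolding hausdorff_pre_measure_def by (intro INF_greatest) auto
  also have "\<dots> \<le> hausdorff_measure (card I) (cbox p q)"
    unfolding hausdorff_measure_def by (intro SUP_upper) auto
  finally show ?thesis .
qed

text \<open>The box is cut into \<open>N ^ card I\<close> cells of side \<open>h / N\<close>, whose
  total cost is bounded independently of \<open>N\<close>. Finiteness matters because
  \<open>enn2real\<close> sends infinity to 0, which would destroy lower bounds on
  \<open>G\<close>.\<close>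

lemma hausdorff_measure_cbox_finite:
  fixes p q :: "real ^ 'd::finite"
  assumes h: "h \<ge> 0" and I: "\<And>i. i \<in> I \<Longrightarrow> q $ i = p $ i + h" and nI: "\<And>i. i \<notin> I \<Longrightarrow> q $ i = p $ i"
  shows "hausdorff_measure (card I) (cbox p q) < \<infinity>"
proof -
  let ?w = "unit_ball_vol (card I)"
  define K where "K = ennreal (?w * (CARD('d) * h / 2) ^ card I)"
  have "hausdorff_pre_measure (card I) \<delta> (cbox p q) \<le> K" if \<delta>: "\<delta> > 0" for \<delta>
  proof -
    \<comment> \<open>The diameter of a cell is bounded by its l1 norm, at most
      \<open>CARD('d) * (h / N)\<close>; this \<open>N\<close> brings it below
      \<open>\<delta>\<close>.\<close>
    define N where "N = Suc (nat \<lceil>CARD('d) * h / \<delta>\<rceil>)"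
    have N: "N > 0" "CARD('d) * (h / N) \<le> \<delta>"
    proof -
      show "N > 0" by (simp add: N_def)
      have "CARD('d) * h / \<delta> \<le> N" unfolding N_def by linarith
      then show "CARD('d) * (h / N) \<le> \<delta>" using \<delta> \<open>N > 0\<close> by (simp add: field_simps)
    qed
    define F where "F = PiE I (\<lambda>_. {..<N})"
    have F: "finite F" "card F = N ^ card I" by (auto simp: F_def finite_PiE card_PiE)
    \<comment> \<open>Covers are sequences, so the finitely many cells are enumerated and followed
      by empty sets, which cost nothing.\<close>
    obtain e where e: "bij_betw e {0..<card F} F" using ex_bij_betw_nat_finite[OF F(1)] by blast
    define C where "C f = cbox (\<chi> i. if i \<in> I then p $ i + real (f i) * (h / N) else p $ i)
       (\<chi> i. if i \<in> I then p $ i + real (Suc (f i)) * (h / N) else p $ i)" for f :: "'d \<Rightarrow> nat"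
    define U where "U n = (if n < card F then C (e n) else {})" for n
    have diam: "diameter (C f) \<le> CARD('d) * (h / N)" for f
    proof (rule diameter_le)
      show "C f \<noteq> {} \<or> 0 \<le> CARD('d) * (h / N)" using h by auto
      fix x y assume x: "x \<in> C f" and y: "y \<in> C f"
      have "norm (x - y) \<le> (\<Sum>i\<in>UNIV. \<bar>(x - y) $ i\<bar>)" by (rule norm_le_l1_cart)
      also have "\<dots> \<le> (\<Sum>i\<in>(UNIV :: 'd set). h / N)"
      proof (intro sum_mono)
        fix i
        show "\<bar>(x - y) $ i\<bar> \<le> h / N"
        proof (cases "i \<in> I")
          case True
          have "p $ i + real (f i) * (h / N) \<le> x $ i" "x $ i \<le> p $ i + real (Suc (f i)) * (h / N)"
               "p $ i + real (f i) * (h / N) \<le> y $ i" "y $ i \<le> p $ i + real (Suc (f i)) * (h / N)"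
            using x y True unfolding C_def mem_box_cart by (auto dest!: spec[of _ i])
          moreover have "real (Suc (f i)) * (h / N) = real (f i) * (h / N) + h / N"
            by (simp only: of_nat_Suc distrib_right mult_1_left)
          ultimately show ?thesis by (simp add: abs_le_iff)
        next
          case False
          have "x $ i = p $ i" "y $ i = p $ i"
            using x y False unfolding C_def mem_box_cart by (auto dest!: spec[of _ i])
          then show ?thesis using h by simp
        qed
      qed
      finally show "norm (x - y) \<le> CARD('d) * (h / N)" by simp
    qed
    have bdd: "bounded (U n)" for n by (simp add: U_def C_def bounded_cbox)
    have dU: "diameter (U n) \<le> CARD('d) * (h / N)" for n
      using diam h by (auto simp: U_def)
    have "cbox p q \<subseteq> (\<Union>n. U n)"
    proof
      fix x assume x: "x \<in> cbox p q"
      have *: "\<exists>m<N. real m * (h / N) \<le> x $ i - p $ i \<and> x $ i - p $ i \<le> real (Suc m) * (h / N)" if i: "i \<in> I" for i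
      proof -
        define t where "t = x $ i - p $ i"
        have t: "0 \<le> t" "t \<le> h" using x I[OF i] by (auto simp: t_def mem_box_cart dest!: spec[of _ i])
        show ?thesis
        proof (cases "t = h")
          \<comment> \<open>The right end point belongs to the last cell, where rounding down would
            give the index \<open>N\<close>.\<close>
          case True
          have "real (N - 1) * (h / N) \<le> real N * (h / N)" using h by (intro mult_right_mono) auto
          then have "real (N - 1) * (h / N) \<le> h" using N by simp
          moreover have "real (Suc (N - 1)) * (h / N) = h" using N by simp
          ultimately show ?thesis using N True unfolding t_def[symmetric] by (intro exI[of _ "N - 1"]) auto
        next
          case False
          then have lt: "t < h" using t by simp
          then have hp: "h > 0" using t by simp
          define m where "m = nat \<lfloor>t * N / h\<rfloor>"
          have "0 \<le> t * N / h" using t hp by simp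
          then have m: "real m \<le> t * N / h" "t * N / h < real m + 1"
            unfolding m_def by linarith+
          have "t * N / h < N" using lt hp N by (simp add: field_simps)
          then have "m < N" using m by linarith
          moreover have "real m * (h / N) \<le> t" "t \<le> real (Suc m) * (h / N)"
            using m hp N by (simp_all add: field_simps)
          ultimately show ?thesis unfolding t_def[symmetric] by blast
        qed
      qed
      then obtain g where g: "\<And>i. i \<in> I \<Longrightarrow> g i < N \<and> real (g i) * (h / N) \<le> x $ i - p $ i \<and> x $ i - p $ i \<le> real (Suc (g i)) * (h / N)"
        by metis
      define f where "f = restrict g I"
      have "f \<in> F" using g by (auto simp: f_def F_def)
      then have "f \<in> e ` {0..<card F}" using e by (simp add: bij_betw_def)
      then obtain n where n: "n < card F" "e n = f" by auto
      have "x \<in> C f"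
        unfolding C_def mem_box_cart
      proof (intro allI)
        fix i
        show "(\<chi> i. if i \<in> I then p $ i + real (f i) * (h / N) else p $ i) $ i \<le> x $ i \<and>
          x $ i \<le> (\<chi> i. if i \<in> I then p $ i + real (Suc (f i)) * (h / N) else p $ i) $ i"
        proof (cases "i \<in> I")
          case True
          then show ?thesis using g[OF True] by (simp add: f_def del: of_nat_Suc)
        next
          case False
          then show ?thesis using x nI[OF False] by (auto simp: mem_box_cart dest!: spec[of _ i])
        qed
      qed
      then show "x \<in> (\<Union>n. U n)" using n by (auto simp: U_def)
    qed
    then have "hausdorff_pre_measure (card I) \<delta> (cbox p q) \<le>
        (\<Sum>n. if U n = {} then 0 else ennreal (?w * (diameter (U n) / 2) ^ card I))"
      unfolding hausdorff_pre_measure_def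
      using bdd dU N by (intro INF_lower) (auto intro: order_trans)
    also have "\<dots> = (\<Sum>n<card F. if U n = {} then 0 else ennreal (?w * (diameter (U n) / 2) ^ card I))"
      by (intro suminf_finite) (auto simp: U_def)
    also have "\<dots> \<le> (\<Sum>n<card F. ennreal (?w * (CARD('d) * (h / N) / 2) ^ card I))"
      using dU diameter_ge_0[OF bdd]
      by (intro sum_mono) (auto intro!: ennreal_leI mult_left_mono power_mono divide_right_mono)
    also have "\<dots> = ennreal (N ^ card I * (?w * (CARD('d) * (h / N) / 2) ^ card I))"
      using h by (simp add: F ennreal_mult' ennreal_of_nat_eq_real_of_nat)
    also have "N ^ card I * (?w * (CARD('d) * (h / N) / 2) ^ card I) = ?w * (N * (CARD('d) * (h / N) / 2)) ^ card I"
      unfolding power_mult_distrib by (simp only: of_nat_power mult.left_commute)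
    also have "N * (CARD('d) * (h / N) / 2) = CARD('d) * h / 2"
      using N by simp
    also have "ennreal (?w * (CARD('d) * h / 2) ^ card I) = K"
      by (simp only: K_def)
    finally show ?thesis .
  qed
  then have "hausdorff_measure (card I) (cbox p q) \<le> K"
    unfolding hausdorff_measure_def by (intro SUP_least) auto
  also have "K < \<infinity>" by (simp add: K_def)
  finally show ?thesis .
qed

section \<open>Bounds for the functional G\<close>

text \<open>For \<open>I = UNIV\<close> this is the whole space of facets. The estimates see a
  configuration only through its counts in these sets.\<close>

definition facet_space :: "real \<Rightarrow> 'd set \<Rightarrow> ('d::finite) facet set" where
  "facet_space b I = cube b \<times> {2 * b} \<times> (\<lambda>i. axis i 1) ` I"

lemma facet_space_cases:
  assumes "y \<in> facet_space b I"
  obtains z i where "y = (z, 2 * b, axis i 1)" "i \<in> I" "z \<in> cube b" "orientation y = axis i 1"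
  using assms unfolding facet_space_def orientation_def by auto

lemma facet_space_mono: "I \<subseteq> J \<Longrightarrow> facet_space b I \<subseteq> facet_space b J"
  by (auto simp: facet_space_def)

lemma facet_space_Un: "facet_space b (I \<union> J) = facet_space b I \<union> facet_space b J"
  by (auto simp: facet_space_def)

lemma facet_space_disjoint:
  fixes I J :: "'d::finite set"
  shows "I \<inter> J = {} \<Longrightarrow> facet_space b I \<inter> facet_space b J = {}"
  by (auto simp: facet_space_def axis_eq_axis)

lemma mem_facet_set:
  "s \<in> facet_set (z, 2 * b, axis i 1) \<longleftrightarrow> s $ i = z $ i \<and> (\<forall>j. \<bar>z $ j - s $ j\<bar> \<le> b)"
  by (simp add: facet_set_def inner_axis)

text \<open>All centres lie in the cube, so every facet meets \<open>cube b\<close> in a full slice of it.\<close>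

lemma hausdorff_measure_facets:
  fixes ys :: "('d::finite) facet list"
  assumes b: "b > 0" and ne: "ys \<noteq> []" and ys: "set ys \<subseteq> facet_space b UNIV" and dist: "distinct (map orientation ys)"
  defines "k \<equiv> CARD('d) - length ys"
  shows "ennreal (unit_ball_vol k * (b / 4) ^ k) \<le> hausdorff_measure k (\<Inter>y\<in>set ys. facet_set y)"
    and "hausdorff_measure k (\<Inter>y\<in>set ys. facet_set y) < \<infinity>"
    and "length ys \<le> card {i. set ys \<inter> facet_space b {i} \<noteq> {}}"
proof -
  have "\<forall>y\<in>set ys. \<exists>i z. y = (z, 2 * b, axis i 1) \<and> z \<in> cube b"
    using ys by (fastforce simp: facet_space_def)
  then obtain ix zz where y: "\<And>y. y \<in> set ys \<Longrightarrow> y = (zz y, 2 * b, axis (ix y) 1) \<and> zz y \<in> cube b"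
    by metis
  then have ori: "orientation y = axis (ix y) 1" if "y \<in> set ys" for y
    using that unfolding orientation_def by (metis snd_conv)
  have inj: "inj_on ix (set ys)"
    using dist ori unfolding distinct_map inj_on_def by metis
  define J where "J = ix ` set ys"
  have cJ: "card J = length ys"
    using dist inj by (simp add: J_def card_image distinct_map distinct_card)
  define I where "I = - J"
  have cI: "card I = k" by (simp add: I_def k_def Compl_eq_Diff_UNIV card_Diff_subset cJ)
  \<comment> \<open>Orientations are distinct, so exactly one facet of the list fixes each
    coordinate in \<open>J\<close>; \<open>w\<close> collects the fixed values.\<close>
  define w where "w i = zz (inv_into (set ys) ix i) $ i" for i
  have w: "w (ix y) = zz y $ ix y" if "y \<in> set ys" for y
    using inj that by (simp add: w_def)
  have zb: "0 \<le> zz y $ l \<and> zz y $ l \<le> b" if "y \<in> set ys" for y l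
    using y[OF that] by (auto simp: cube_def mem_box_cart)
  have mem: "s \<in> facet_set y \<longleftrightarrow> s $ ix y = zz y $ ix y \<and> (\<forall>j. \<bar>zz y $ j - s $ j\<bar> \<le> b)"
    if "y \<in> set ys" for s y
    using y[OF that] mem_facet_set by metis
  have wb: "0 \<le> w i \<and> w i \<le> b" if "i \<in> J" for i
    using that w zb by (auto simp: J_def)
  \<comment> \<open>Two numbers in \<open>[0, b]\<close> differ by at most \<open>b\<close>, so all
    remaining coordinates may range freely over \<open>[0, b]\<close>.\<close>
  have "cbox (\<chi> i. if i \<in> J then w i else 0) (\<chi> i. if i \<in> J then w i else b) \<subseteq> (\<Inter>y\<in>set ys. facet_set y)"
    (is "cbox ?p ?q \<subseteq> _")
  proof (intro INT_greatest subsetI)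
    fix y s assume yy: "y \<in> set ys" and s: "s \<in> cbox ?p ?q"
    have s1: "s $ i = w i" if "i \<in> J" for i
      using s that by (auto simp: mem_box_cart dest!: spec[of _ i])
    have s2: "0 \<le> s $ i \<and> s $ i \<le> b" for i
      using s wb[of i] s1[of i] by (cases "i \<in> J") (auto simp: mem_box_cart dest!: spec[of _ i])
    have "\<bar>zz y $ j - s $ j\<bar> \<le> b" for j
      using s2[of j] zb[OF yy, of j] by linarith
    then show "s \<in> facet_set y"
      using s1[of "ix y"] w[OF yy] yy by (simp add: mem J_def)
  qed
  then have "hausdorff_measure k (cbox ?p ?q) \<le> hausdorff_measure k (\<Inter>y\<in>set ys. facet_set y)"
    by (rule hausdorff_measure_mono)
  moreover have "ennreal (unit_ball_vol (card I) * (b / 4) ^ card I) \<le> hausdorff_measure (card I) (cbox ?p ?q)"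
    using b by (intro hausdorff_measure_cbox_ge) (auto simp: I_def)
  ultimately show "ennreal (unit_ball_vol k * (b / 4) ^ k) \<le> hausdorff_measure k (\<Inter>y\<in>set ys. facet_set y)"
    unfolding cI by (rule order_trans[rotated])
  have "J \<subseteq> {i. set ys \<inter> facet_space b {i} \<noteq> {}}"
    using y by (force simp: J_def facet_space_def)
  then show "length ys \<le> card {i. set ys \<inter> facet_space b {i} \<noteq> {}}"
    unfolding cJ[symmetric] by (intro card_mono) auto
  show "hausdorff_measure k (\<Inter>y\<in>set ys. facet_set y) < \<infinity>"
  proof -
    \<comment> \<open>Points of a facet are within \<open>b\<close> of a centre coordinate in
      \<open>[0, b]\<close>, hence lie in an interval of length \<open>3 * b\<close>.\<close>
    have "(\<Inter>y\<in>set ys. facet_set y) \<subseteq> cbox (\<chi> i. if i \<in> J then w i else - b) (\<chi> i. if i \<in> J then w i else 2 * b)"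
      (is "_ \<subseteq> cbox ?p ?q")
    proof
      fix s assume s: "s \<in> (\<Inter>y\<in>set ys. facet_set y)"
      obtain y0 where y0: "y0 \<in> set ys" using ne by (cases ys) auto
      have "s $ i = w i" if "i \<in> J" for i
        using that s w mem by (auto simp: J_def)
      moreover have "- b \<le> s $ i \<and> s $ i \<le> 2 * b" for i
      proof -
        have "\<bar>zz y0 $ i - s $ i\<bar> \<le> b" using s y0 mem by auto
        then show ?thesis using zb[OF y0, of i] by linarith
      qed
      ultimately show "s \<in> cbox ?p ?q" by (simp add: mem_box_cart)
    qed
    then have "hausdorff_measure k (\<Inter>y\<in>set ys. facet_set y) \<le> hausdorff_measure k (cbox ?p ?q)"
      by (rule hausdorff_measure_mono)
    also have "\<dots> < \<infinity>"
      unfolding cI[symmetric] by (rule hausdorff_measure_cbox_finite[where h = "3 * b"]) (use b in \<open>auto simp: I_def\<close>)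
    finally show ?thesis .
  qed
qed

section \<open>Vanishing and growth of \<open>G\<close>\<close>

lemma G_nonneg: "0 \<le> G j x"
  unfolding G_def by (simp add: sum_nonneg)

text \<open>A tuple counted by \<open>G j\<close> shows \<open>j\<close> distinct orientations, so
  the sum is empty.\<close>

lemma G_eq_0:
  fixes x :: "('d::finite) facet set"
  assumes "b > 0" "x \<subseteq> facet_space b UNIV" "card {i. x \<inter> facet_space b {i} \<noteq> {}} < j"
  shows "G j x = 0"
proof -
  have "{ys. length ys = j \<and> distinct ys \<and> set ys \<subseteq> x \<and> distinct (map orientation ys)} = {}"
  proof safe
    fix ys :: "'d facet list"
    assume ys: "j = length ys" "set ys \<subseteq> x" "distinct (map orientation ys)"
    then have "length ys \<le> card {i. set ys \<inter> facet_space b {i} \<noteq> {}}"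
      using assms by (intro hausdorff_measure_facets(3)) auto
    also have "\<dots> \<le> card {i. x \<inter> facet_space b {i} \<noteq> {}}"
      using ys by (intro card_mono) auto
    finally show "ys \<in> {}" using assms ys by simp
  qed
  then show ?thesis unfolding G_def by (simp only: sum.empty mult_zero_right)
qed

text \<open>A lower bound for the share of one ordered \<open>j\<close>-tuple in \<open>G j\<close>,
  with the factor \<open>1 / fact j\<close> included; \<open>d\<close> is the dimension.\<close>

definition min_intersection :: "nat \<Rightarrow> nat \<Rightarrow> real \<Rightarrow> real" where
  "min_intersection d j b = unit_ball_vol (d - j) * (b / 4) ^ (d - j) / fact j"

lemma min_intersection_pos: "b > 0 \<Longrightarrow> min_intersection d j b > 0"
  unfolding min_intersection_def by simp

text \<open>With one representative fixed for each orientation in \<open>A - {a}\<close>, every pair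
  of a facet of orientation \<open>a\<close> and a facet of orientation outside \<open>A\<close>
  extends to a \<open>j\<close>-tuple counted by \<open>G\<close>.\<close>

lemma G_ge:
  fixes x :: "('d::finite) facet set"
  assumes b: "b > 0" and x: "finite x" "x \<subseteq> facet_space b UNIV"
    and A: "card A = j - 1" "a \<in> A" "\<And>i. i \<in> A \<Longrightarrow> x \<inter> facet_space b {i} \<noteq> {}"
  shows "min_intersection CARD('d) j b * card (x \<inter> facet_space b {a}) * card (x \<inter> facet_space b (- A)) \<le> G j x"
proof -
  define T where "T = {ys. length ys = j \<and> distinct ys \<and> set ys \<subseteq> x \<and> distinct (map orientation ys)}"
  define c where "c = unit_ball_vol (CARD('d) - j) * (b / 4) ^ (CARD('d) - j)"
  define f where "f ys = enn2real (hausdorff_measure (CARD('d) - j) (\<Inter>y\<in>set ys. facet_set y))" for ys :: "'d facet list"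
  have "T \<subseteq> {ys. set ys \<subseteq> x \<and> length ys = j}" by (auto simp: T_def)
  then have finT: "finite T" using finite_lists_length_eq[OF x(1)] finite_subset by blast
  have fc: "c \<le> f ys" if "ys \<in> T" for ys
  proof -
    have ys: "set ys \<subseteq> facet_space b UNIV" "distinct (map orientation ys)" "length ys = j"
      using that x by (auto simp: T_def)
    \<comment> \<open>This excludes \<open>j = 0\<close>, where the empty list would have the whole
      space as its intersection.\<close>
    moreover have "card A > 0" using A(2) by (metis card_gt_0_iff finite empty_iff)
    ultimately have ne: "ys \<noteq> []" using A by auto
    have c: "c \<ge> 0" using b by (simp add: c_def)
    note H = hausdorff_measure_facets[OF b ne ys(1,2), unfolded ys(3), folded c_def]
    have "enn2real (ennreal c) \<le> f ys" unfolding f_def using H by (intro enn2real_mono) auto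
    then show ?thesis using c by simp
  qed
  have "\<forall>i\<in>A. \<exists>y. y \<in> x \<inter> facet_space b {i}" using A(3) by blast
  then obtain r where r: "\<And>i. i \<in> A \<Longrightarrow> r i \<in> x \<inter> facet_space b {i}" by metis
  obtain L where L: "set L = A - {a}" "distinct L" using finite_distinct_list[of "A - {a}"] by auto
  have lenL: "length L + 2 = j"
  proof -
    have "length L = card (A - {a})" using L by (metis distinct_card)
    moreover have "card A > 0" using A(2) by (metis card_gt_0_iff finite empty_iff)
    ultimately show ?thesis using A by simp
  qed
  \<comment> \<open>The pair occupies the first two places, so it can be recovered from the tuple
    and \<open>\<Phi>\<close> is injective.\<close>
  define \<Phi> where "\<Phi> p = fst p # snd p # map r L" for p :: "'d facet \<times> 'd facet"
  let ?X = "(x \<inter> facet_space b {a}) \<times> (x \<inter> facet_space b (- A))"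
  have inj: "inj_on \<Phi> ?X" by (auto simp: inj_on_def \<Phi>_def)
  have sub: "\<Phi> ` ?X \<subseteq> T"
  proof
    fix ys assume "ys \<in> \<Phi> ` ?X"
    then obtain y y' where yy: "ys = y # y' # map r L" "y \<in> x" "y \<in> facet_space b {a}" "y' \<in> x" "y' \<in> facet_space b (- A)"
      by (auto simp: \<Phi>_def)
    have "orientation (r i) = axis i 1" if "i \<in> A" for i
      using r[OF that] by (auto simp: facet_space_def orientation_def)
    then have mapr: "map orientation (map r L) = map (\<lambda>i. axis i 1) L" using L by auto
    obtain i' where i': "i' \<notin> A" "orientation y' = axis i' 1" using yy by (auto elim!: facet_space_cases)
    have "orientation y = axis a 1" using yy by (auto elim!: facet_space_cases)
    then have "map orientation ys = map (\<lambda>i. axis i 1) (a # i' # L)" using yy mapr i' by simp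
    moreover have "distinct (a # i' # L)" using L i' A by auto
    moreover have "inj (\<lambda>i. axis i 1 :: real ^ 'd)" by (auto simp: inj_on_def axis_eq_axis)
    ultimately have d: "distinct (map orientation ys)"
      by (metis distinct_map inj_on_subset subset_UNIV)
    then have "distinct ys" by (simp add: distinct_map)
    moreover have "set ys \<subseteq> x" using yy r L by auto
    moreover have "length ys = j" using yy lenL by simp
    ultimately show "ys \<in> T" using d by (simp add: T_def)
  qed
  have "real (card (x \<inter> facet_space b {a})) * real (card (x \<inter> facet_space b (- A))) * c = (\<Sum>ys\<in>\<Phi> ` ?X. c)"
    using inj by (simp add: card_image card_cartesian_product)
  also have "\<dots> \<le> (\<Sum>ys\<in>\<Phi> ` ?X. f ys)" using sub fc by (intro sum_mono) auto
  also have "\<dots> \<le> (\<Sum>ys\<in>T. f ys)" using finT sub by (intro sum_mono2) (auto simp: f_def)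
  finally have "real (card (x \<inter> facet_space b {a})) * real (card (x \<inter> facet_space b (- A))) * c / fact j \<le> (\<Sum>ys\<in>T. f ys) / fact j"
    by (intro divide_right_mono) auto
  then show ?thesis
    unfolding G_def T_def[symmetric] f_def[symmetric] min_intersection_def c_def[symmetric]
    by (simp add: mult_ac)
qed

lemma card_facet_space_sum:
  fixes x :: "('d::finite) facet set"
  assumes "finite x"
  shows "card (x \<inter> facet_space b I) = (\<Sum>i\<in>I. card (x \<inter> facet_space b {i}))"
  using finite[of I]
proof induction
  case empty
  then show ?case by (simp add: facet_space_def)
next
  case (insert i I)
  have "x \<inter> facet_space b (insert i I) = (x \<inter> facet_space b {i}) \<union> (x \<inter> facet_space b I)"
    using facet_space_Un[of b "{i}" I] by auto
  moreover have "(x \<inter> facet_space b {i}) \<inter> (x \<inter> facet_space b I) = {}"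
    using facet_space_disjoint[of "{i}" I b] insert by auto
  ultimately show ?case using insert assms by (simp add: card_Un_disjoint)
qed

text \<open>Either few orientations are frequent, so that \<open>q + 1\<close> of them are rare, or \<open>j - 1\<close> of them are
  frequent and \<open>G\<close> is large as soon as a further orientation occurs.\<close>

lemma weighted_G_le:
  fixes x :: "('d::finite) facet set"
  assumes b: "b > 0" and x: "finite x" "x \<subseteq> facet_space b UNIV"
    and j: "2 \<le> j" "j + q = CARD('d) + 1" and \<nu>: "\<nu> < 0" and L: "L > 0" and \<sigma>: "\<sigma> > 0"
  defines "\<gamma> \<equiv> - \<nu> / 2 * min_intersection CARD('d) j b * L"
  shows "exp (\<nu> * G j x) * G j x \<le> - 2 / \<nu> *
    ((\<Sum>I | card I = q + 1. exp (real (q + 1) * L * \<sigma>) * exp (- \<sigma>) ^ card (x \<inter> facet_space b I)) +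
     (\<Sum>A | card A = j - 1. if card (x \<inter> facet_space b (- A)) = 0 then 0 else exp (- \<gamma>) ^ card (x \<inter> facet_space b (- A))))"
    (is "_ \<le> _ * (sum ?f ?II + sum ?g ?AA)")
proof (cases "G j x = 0")
  case True
  have "0 \<le> - 2 / \<nu> * (sum ?f ?II + sum ?g ?AA)"
    using \<nu> by (intro mult_nonneg_nonneg add_nonneg_nonneg sum_nonneg) (auto simp: divide_nonpos_neg)
  then show ?thesis using True by simp
next
  case False
  define n where "n i = card (x \<inter> facet_space b {i})" for i
  have n0: "x \<inter> facet_space b {i} \<noteq> {} \<longleftrightarrow> n i > 0" for i
    using x by (simp add: n_def card_gt_0_iff)
  have N: "card (x \<inter> facet_space b I) = (\<Sum>i\<in>I. n i)" for I
    unfolding n_def using x by (intro card_facet_space_sum)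
  have E: "card {i. n i > 0} \<ge> j"
    using G_eq_0[OF b x(2), of j] False by (force simp: n0)
  \<comment> \<open>Half of the exponent: \<open>exp (\<nu> * G j x)\<close> is
    \<open>exp (- g)\<close> squared. One factor absorbs \<open>G\<close> through
    \<open>exp (- g) * g \<le> 1\<close>, the other is kept for the decay.\<close>
  define g where "g = - \<nu> / 2 * G j x"
  have g0: "g \<ge> 0" using \<nu> G_nonneg[of j x] by (auto simp: g_def intro: mult_nonpos_nonneg)
  have "exp (\<nu> * G j x) * G j x = - 2 / \<nu> * (exp (- g) * (exp (- g) * g))"
    using \<nu> by (simp add: g_def exp_add[symmetric] field_simps)
  also have "\<dots> \<le> - 2 / \<nu> * (exp (- g) * 1)"
  proof (intro mult_left_mono)
    have "g \<le> exp g" using exp_ge_add_one_self[of g] by linarith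
    then show "exp (- g) * g \<le> 1" by (simp add: exp_minus field_simps)
  qed (use \<nu> in \<open>auto simp: divide_nonpos_neg\<close>)
  also have "exp (- g) * 1 \<le> sum ?f ?II + sum ?g ?AA"
  proof (cases "card {i. L < n i} \<ge> j - 1")
    case True
    then obtain A where A: "A \<subseteq> {i. L < n i}" "card A = j - 1"
      using obtain_subset_with_card_n by metis
    have "A \<noteq> {}" using A j by auto
    then obtain a where a: "a \<in> A" by auto
    \<comment> \<open>At least \<open>j\<close> orientations occur, one more than \<open>A\<close>
      holds; the extra one makes the count outside \<open>A\<close> positive, so \<open>?g A\<close>
      is not 0.\<close>
    have "\<not> {i. n i > 0} \<subseteq> A" using E A j card_mono[of A "{i. n i > 0}"] by (auto simp: not_le)
    then obtain i where i: "n i > 0" "i \<notin> A" by auto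
    have "facet_space b {i} \<subseteq> facet_space b (- A)" using i by (intro facet_space_mono) auto
    then have pos: "card (x \<inter> facet_space b (- A)) > 0"
      using i x by (auto simp: card_gt_0_iff simp flip: n0)
    define S where "S = card (x \<inter> facet_space b (- A))"
    have "x \<inter> facet_space b {i} \<noteq> {}" if "i \<in> A" for i
      unfolding n0 using A(1) L that by (auto intro: gr0I)
    then have "min_intersection CARD('d) j b * n a * S \<le> G j x"
      unfolding n_def S_def by (intro G_ge[OF b x A(2) a])
    moreover have "min_intersection CARD('d) j b * L * S \<le> min_intersection CARD('d) j b * n a * S"
      using A a min_intersection_pos[OF b, of "CARD('d)" j] by (intro mult_right_mono mult_left_mono) auto
    ultimately have "- \<nu> / 2 * (min_intersection CARD('d) j b * L * S) \<le> g"
      unfolding g_def using \<nu> by (intro mult_left_mono) auto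
    then have "\<gamma> * S \<le> g" by (simp add: \<gamma>_def mult_ac)
    then have "exp (- g) * 1 \<le> ?g A"
      using pos unfolding S_def[symmetric] by (simp add: exp_of_nat_mult[symmetric] mult_ac)
    also have "\<dots> \<le> sum ?g ?AA" using A by (intro member_le_sum) auto
    also have "\<dots> \<le> sum ?f ?II + sum ?g ?AA" by (simp add: sum_nonneg)
    finally show ?thesis .
  next
    case False
    \<comment> \<open>At most \<open>j - 2\<close> orientations are frequent, which leaves at least
      \<open>CARD('d) - (j - 2) = q + 1\<close>.\<close>
    have "card (- {i. L < n i}) \<ge> q + 1"
      using False j by (simp add: Compl_eq_Diff_UNIV card_Diff_subset)
    then obtain I where I: "I \<subseteq> - {i. L < n i}" "card I = q + 1"
      using obtain_subset_with_card_n by metis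
    define S where "S = card (x \<inter> facet_space b I)"
    have "real S = (\<Sum>i\<in>I. real (n i))" by (simp add: S_def N)
    also have "\<dots> \<le> (\<Sum>i\<in>I. L)" using I by (intro sum_mono) auto
    finally have "real S \<le> real (q + 1) * L" using I by simp
    \<comment> \<open>Exponential Markov bound: on this event \<open>?f I\<close> is at least 1,
      while \<open>exp (- g)\<close> is at most 1.\<close>
    then have "real S * \<sigma> \<le> real (q + 1) * L * \<sigma>" using \<sigma> by (intro mult_right_mono) auto
    then have "exp (- g) * 1 \<le> ?f I"
      using g0 unfolding S_def[symmetric] by (simp add: exp_of_nat_mult[symmetric] exp_add[symmetric] mult_ac)
    also have "\<dots> \<le> sum ?f ?II" using I by (intro member_le_sum) auto
    also have "\<dots> \<le> sum ?f ?II + sum ?g ?AA" by (simp add: sum_nonneg)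
    finally show ?thesis .
  qed
  then have "- 2 / \<nu> * (exp (- g) * 1) \<le> - 2 / \<nu> * (sum ?f ?II + sum ?g ?AA)"
    using \<nu> by (intro mult_left_mono) (auto simp: divide_nonpos_neg)
  finally show ?thesis .
qed

section \<open>Counts of facets\<close>

lemma space_config_space: "space (config_space M) = {x. finite x \<and> x \<subseteq> space M}"
  by (simp add: config_space_def space_measure_of_conv)

lemma count_event_in_config_space:
  assumes "B \<in> sets M"
  shows "{x \<in> space (config_space M). card (x \<inter> B) = n} \<in> sets (config_space M)"
proof -
  have "{x. finite x \<and> x \<subseteq> space M \<and> card (x \<inter> B) = n} \<in> sets (config_space M)"
    unfolding config_space_def using assms by (subst sets_measure_of) (auto intro!: sigma_sets.Basic)
  moreover have "{x \<in> space (config_space M). card (x \<inter> B) = n} = {x. finite x \<and> x \<subseteq> space M \<and> card (x \<inter> B) = n}"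
    by (auto simp: space_config_space)
  ultimately show ?thesis by simp
qed

text \<open>The probability generating function of the Poisson distribution with mean
  \<open>M\<close>.\<close>

lemma poisson_sums:
  fixes t M :: real
  shows "(\<lambda>n. t ^ n * (M ^ n / fact n * exp (- M))) sums exp (- M * (1 - t))"
proof -
  have "(\<lambda>n. exp (- M) * ((t * M) ^ n /\<^sub>R fact n)) sums (exp (- M) * exp (t * M))"
    by (intro sums_mult exp_converges)
  then show ?thesis
    by (simp add: power_mult_distrib field_simps exp_add[symmetric] scaleR_conv_of_real)
qed

section \<open>Expectations of functions of a single Poisson count\<close>

context
  fixes \<Lambda> :: "'y measure" and P
  assumes poi: "poisson_process \<Lambda> P"
begin

lemma space_poisson_process: "space P = {x. finite x \<and> x \<subseteq> space \<Lambda>}"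
  using poi sets_eq_imp_space_eq[of P "config_space \<Lambda>"]
  by (simp add: poisson_process_def space_config_space)

lemma poisson_count_event:
  assumes "B \<in> sets \<Lambda>"
  shows "{x \<in> space P. card (x \<inter> B) = n} \<in> sets P"
proof -
  have "sets P = sets (config_space \<Lambda>)" using poi by (simp add: poisson_process_def)
  then show ?thesis using count_event_in_config_space[OF assms] sets_eq_imp_space_eq by metis
qed

lemma poisson_count_measurable:
  assumes "B \<in> sets \<Lambda>"
  shows "(\<lambda>x. ennreal (f (card (x \<inter> B)))) \<in> borel_measurable P"
proof -
  have "(\<lambda>x. card (x \<inter> B)) \<in> measurable P (count_space UNIV)"
  proof (rule measurable_count_space_eq_countable[THEN iffD2])
    have "(\<lambda>x. card (x \<inter> B)) -` {n} \<inter> space P = {x \<in> space P. card (x \<inter> B) = n}" for n by auto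
    then show "(\<lambda>x. card (x \<inter> B)) \<in> space P \<rightarrow> UNIV \<and> (\<forall>a\<in>UNIV. (\<lambda>x. card (x \<inter> B)) -` {a} \<inter> space P \<in> sets P)"
      using poisson_count_event[OF assms] by auto
  qed auto
  then show ?thesis by measurable
qed

lemma nn_integral_poisson_count:
  assumes B: "B \<in> sets \<Lambda>" and f: "\<And>n. f n \<ge> 0"
    and v: "(\<lambda>n. f n * (measure \<Lambda> B ^ n / fact n * exp (- measure \<Lambda> B))) sums v"
  shows "(\<integral>\<^sup>+x. ennreal (f (card (x \<inter> B))) \<partial>P) = ennreal v"
proof -
  interpret prob_space P using poi by (simp add: poisson_process_def)
  have meas: "measure P {x \<in> space P. card (x \<inter> B) = n} = measure \<Lambda> B ^ n / fact n * exp (- measure \<Lambda> B)" for n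
    using poi B by (simp add: poisson_process_def)
  have "(\<integral>\<^sup>+x. ennreal (f (card (x \<inter> B))) \<partial>P) =
      (\<integral>\<^sup>+x. (\<Sum>n. ennreal (f n) * indicator {x \<in> space P. card (x \<inter> B) = n} x) \<partial>P)"
  proof (intro nn_integral_cong)
    fix x assume x: "x \<in> space P"
    have "(\<lambda>n. ennreal (f n) * indicator {x \<in> space P. card (x \<inter> B) = n} x) =
        (\<lambda>n. if n = card (x \<inter> B) then ennreal (f n) else 0)"
      using x by (auto simp: fun_eq_iff)
    then show "ennreal (f (card (x \<inter> B))) = (\<Sum>n. ennreal (f n) * indicator {x \<in> space P. card (x \<inter> B) = n} x)"
      using sums_unique[OF sums_single[of "card (x \<inter> B)" "\<lambda>n. ennreal (f n)"]] by simp
  qed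
  also have "\<dots> = (\<Sum>n. ennreal (f n) * emeasure P {x \<in> space P. card (x \<inter> B) = n})"
    using poisson_count_event[OF B] by (subst nn_integral_suminf) (auto simp: nn_integral_cmult_indicator)
  also have "\<dots> = (\<Sum>n. ennreal (f n * (measure \<Lambda> B ^ n / fact n * exp (- measure \<Lambda> B))))"
    using f by (simp only: emeasure_eq_measure meas ennreal_mult')
  also have "\<dots> = ennreal v"
    using v f by (intro suminf_ennreal_eq) auto
  finally show ?thesis .
qed

lemma nn_integral_poisson_power:
  assumes "B \<in> sets \<Lambda>" "t \<ge> 0"
  shows "(\<integral>\<^sup>+x. ennreal (t ^ card (x \<inter> B)) \<partial>P) = ennreal (exp (- measure \<Lambda> B * (1 - t)))"
  using assms by (intro nn_integral_poisson_count poisson_sums) auto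

text \<open>Requiring at least one point removes the term \<open>n = 0\<close> of the generating
  series. This subtraction is what makes the contribution of frequent orientations
  negligible.\<close>

lemma nn_integral_poisson_power_pos:
  assumes "B \<in> sets \<Lambda>" "t \<ge> 0"
  shows "(\<integral>\<^sup>+x. ennreal (if card (x \<inter> B) = 0 then 0 else t ^ card (x \<inter> B)) \<partial>P) =
    ennreal (exp (- measure \<Lambda> B * (1 - t)) - exp (- measure \<Lambda> B))"
proof (intro nn_integral_poisson_count assms)
  let ?w = "\<lambda>n. measure \<Lambda> B ^ n / fact n * exp (- measure \<Lambda> B)"
  have "(\<lambda>n. t ^ n * ?w n - (if n = 0 then ?w n else 0)) sums
      (exp (- measure \<Lambda> B * (1 - t)) - ?w 0)"
    by (intro sums_diff poisson_sums sums_single)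
  moreover have "t ^ n * ?w n - (if n = 0 then ?w n else 0) = (if n = 0 then 0 else t ^ n) * ?w n" for n
    by simp
  ultimately show "(\<lambda>n. (if n = 0 then 0 else t ^ n) * ?w n) sums
      (exp (- measure \<Lambda> B * (1 - t)) - exp (- measure \<Lambda> B))" by simp
qed (use assms in auto)

end

section \<open>Intensity of the facets with prescribed orientations\<close>

context
  fixes b :: real and chi :: "real ^ 'd::finite \<Rightarrow> real"
  assumes b: "b > 0" and meas: "chi \<in> borel_measurable (restrict_space borel (cube b))"
    and nonneg: "\<And>z. z \<in> cube b \<Longrightarrow> 0 \<le> chi z"
    and pos: "(LINT z:cube b|lborel. chi z) > 0"
begin

lemma space_facet_intensity: "space (facet_intensity b chi) = facet_space b UNIV"
  by (simp add: facet_intensity_def facet_space_def space_pair_measure space_restrict_space space_uniform_count_measure)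

lemma facet_space_sets: "facet_space b I \<in> sets (facet_intensity b chi)"
proof -
  have "cube b \<in> sets (density (restrict_space lborel (cube b)) (\<lambda>z. ennreal (chi z)))"
    by (simp add: sets_restrict_space_iff cube_def)
  then show ?thesis
    unfolding facet_intensity_def facet_space_def
    by (intro pair_measureI) (auto simp: sets_uniform_count_measure)
qed

lemma measure_facet_space:
  "measure (facet_intensity b chi) (facet_space b I) = (LINT z:cube b|lborel. chi z) * card I / CARD('d)"
proof -
  define T where "T = (LINT z:cube b|lborel. chi z)"
  let ?R = "restrict_space lborel (cube b)" and ?ax = "\<lambda>i. axis i 1 :: real ^ 'd"
  let ?M2 = "return (count_space {2 * b}) (2 * b)" and ?M3 = "uniform_count_measure (range ?ax)"
  have inj: "inj ?ax" by (auto simp: inj_on_def axis_eq_axis)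
  interpret M2: prob_space ?M2 by (rule prob_space_return) simp
  interpret M3: prob_space ?M3 by (rule prob_space_uniform_count_measure) auto
  interpret M23: pair_prob_space ?M2 ?M3 ..
  have cube: "cube b \<in> sets lborel" by (simp add: cube_def)
  have cR: "cube b \<in> sets ?R"
    using cube sets.top[of ?R] by (simp add: space_restrict_space)
  have chi: "chi \<in> borel_measurable ?R"
    using meas by (simp cong: measurable_cong_sets add: sets_restrict_space)
  have T: "T = (\<integral>z. chi z \<partial>?R)"
    unfolding T_def set_lebesgue_integral_def using cube by (subst integral_restrict_space) auto
  \<comment> \<open>The Bochner integral of a nonintegrable function is 0, so a positive integral
    forces integrability.\<close>
  then have "integrable ?R chi"
    using pos not_integrable_integral_eq[of ?R chi] by (auto simp: T_def)
  then have nn: "(\<integral>\<^sup>+z. ennreal (chi z) \<partial>?R) = ennreal T"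
    unfolding T using nonneg by (intro nn_integral_eq_integral) (auto simp: space_restrict_space)
  have "emeasure (density ?R (\<lambda>z. ennreal (chi z))) (cube b) = (\<integral>\<^sup>+z. ennreal (chi z) * indicator (cube b) z \<partial>?R)"
    using chi cR by (intro emeasure_density) auto
  also have "\<dots> = (\<integral>\<^sup>+z. ennreal (chi z) \<partial>?R)"
    by (intro nn_integral_cong) (auto simp: space_restrict_space)
  finally have 1: "emeasure (density ?R (\<lambda>z. ennreal (chi z))) (cube b) = ennreal T" using nn by simp
  have "emeasure ?M3 (?ax ` I) = ennreal (card I / CARD('d))"
    using inj by (simp add: emeasure_uniform_count_measure card_image inj_on_subset image_mono)
  then have 2: "emeasure (?M2 \<Otimes>\<^sub>M ?M3) ({2 * b} \<times> ?ax ` I) = ennreal (card I / CARD('d))"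
    by (subst M3.emeasure_pair_measure_Times) (auto simp: sets_uniform_count_measure)
  have "emeasure (facet_intensity b chi) (facet_space b I) = ennreal T * ennreal (card I / CARD('d))"
    unfolding facet_intensity_def facet_space_def using cR 1 2
    by (subst M23.P.emeasure_pair_measure_Times)
      (auto intro!: pair_measureI simp: sets_uniform_count_measure)
  then show ?thesis
    using pos unfolding T_def[symmetric] measure_def by (simp add: ennreal_mult[symmetric])
qed

end

section \<open>The Gibbs process\<close>

context
  fixes b m \<nu> L \<sigma> :: real and \<Lambda> :: "('d::finite) facet measure" and P and j q :: nat
  assumes b: "b > 0" and m: "m \<ge> 0" and \<nu>: "\<nu> < 0" and L: "L > 0" and \<sigma>: "\<sigma> > 0"
    and j: "2 \<le> j" "j + q = CARD('d) + 1"
    and poi: "poisson_process \<Lambda> P"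
    and space_eq: "space \<Lambda> = facet_space b UNIV"
    and facets: "\<And>I. facet_space b I \<in> sets \<Lambda>"
    and intensity: "\<And>I. measure \<Lambda> (facet_space b I) = m * card I"
begin

lemma space_facet_process: "x \<in> space P \<Longrightarrow> finite x \<and> x \<subseteq> facet_space b UNIV"
  using space_poisson_process[OF poi] space_eq by auto

lemma partition_function_ge: "ennreal (exp (- (m * q))) \<le> (\<integral>\<^sup>+x. ennreal (exp (\<nu> * G j x)) \<partial>P)"
proof -
  obtain I :: "'d set" where I: "card I = q"
    using obtain_subset_with_card_n[of q "UNIV :: 'd set"] j by auto
  \<comment> \<open>Since \<open>0 ^ 0 = 1\<close>, this power is the indicator of the event that no
    facet has an orientation in \<open>I\<close>. On that event at most \<open>j - 1\<close>
    orientations are left and the weight equals 1.\<close>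
  have "ennreal (exp (- (m * q))) = (\<integral>\<^sup>+x. ennreal (0 ^ card (x \<inter> facet_space b I)) \<partial>P)"
    using nn_integral_poisson_power[OF poi facets, of 0 I] by (simp add: intensity I)
  also have "\<dots> \<le> (\<integral>\<^sup>+x. ennreal (exp (\<nu> * G j x)) \<partial>P)"
  proof (intro nn_integral_mono)
    fix x assume "x \<in> space P"
    then have x: "finite x" "x \<subseteq> facet_space b UNIV" using space_facet_process by auto
    show "ennreal (0 ^ card (x \<inter> facet_space b I)) \<le> ennreal (exp (\<nu> * G j x))"
    proof (cases "x \<inter> facet_space b I = {}")
      case True
      then have "{i. x \<inter> facet_space b {i} \<noteq> {}} \<subseteq> - I"
        using facet_space_mono[of "{_}" I b] by blast
      then have "card {i. x \<inter> facet_space b {i} \<noteq> {}} \<le> card (- I)" by (intro card_mono) auto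
      also have "\<dots> < j" using j I by (simp add: Compl_eq_Diff_UNIV card_Diff_subset)
      finally have "G j x = 0" using G_eq_0[OF b x(2)] by simp
      then show ?thesis using True by simp
    next
      case False
      then have "card (x \<inter> facet_space b I) \<noteq> 0" using x by simp
      then show ?thesis by (simp add: power_0_left)
    qed
  qed
  finally show ?thesis .
qed

text \<open>The pointwise bound \<open>weighted_G_le\<close> is integrated. Its right side is a sum
  of functions of single counts, hence measurable, and the Poisson formulas apply term by
  term.\<close>

lemma nn_integral_weighted_G_le:
  defines "\<gamma> \<equiv> - \<nu> / 2 * min_intersection CARD('d) j b * L"
  shows "(\<integral>\<^sup>+x. ennreal (exp (\<nu> * G j x) * G j x) \<partial>P) \<le> ennreal (- 2 / \<nu> *
    (card {I :: 'd set. card I = q + 1} * (exp (real (q + 1) * L * \<sigma>) * exp (- (m * real (q + 1)) * (1 - exp (- \<sigma>)))) +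
     card {A :: 'd set. card A = j - 1} * (exp (- (m * real q) * (1 - exp (- \<gamma>))) - exp (- (m * real q)))))"
proof -
  let ?II = "{I :: 'd set. card I = q + 1}" and ?AA = "{A :: 'd set. card A = j - 1}"
  let ?N = "\<lambda>I x. card (x \<inter> facet_space b I)"
  let ?E = "exp (real (q + 1) * L * \<sigma>)"
  let ?f = "\<lambda>I x. ?E * exp (- \<sigma>) ^ ?N I x"
  let ?g = "\<lambda>A x. if ?N (- A) x = 0 then 0 else exp (- \<gamma>) ^ ?N (- A) x"
  have K: "- 2 / \<nu> \<ge> 0" using \<nu> by (simp add: divide_nonpos_neg)
  have mf: "(\<lambda>x. ennreal (?f I x)) \<in> borel_measurable P" for I
    by (rule poisson_count_measurable[OF poi facets, of "\<lambda>n. ?E * exp (- \<sigma>) ^ n"])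
  have mg: "(\<lambda>x. ennreal (?g A x)) \<in> borel_measurable P" for A
    by (rule poisson_count_measurable[OF poi facets, of "\<lambda>n. if n = 0 then 0 else exp (- \<gamma>) ^ n"])
  have F: "(\<integral>\<^sup>+x. ennreal (?f I x) \<partial>P) = ennreal (?E * exp (- (m * real (q + 1)) * (1 - exp (- \<sigma>))))"
    if "card I = q + 1" for I
  proof -
    have "(\<integral>\<^sup>+x. ennreal (?f I x) \<partial>P) = (\<integral>\<^sup>+x. ennreal ?E * ennreal (exp (- \<sigma>) ^ ?N I x) \<partial>P)"
      by (simp only: ennreal_mult' exp_ge_zero)
    also have "\<dots> = ennreal ?E * (\<integral>\<^sup>+x. ennreal (exp (- \<sigma>) ^ ?N I x) \<partial>P)"
      by (intro nn_integral_cmult poisson_count_measurable[OF poi facets])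
    also have "\<dots> = ennreal ?E * ennreal (exp (- (m * real (q + 1)) * (1 - exp (- \<sigma>))))"
      by (subst nn_integral_poisson_power[OF poi facets]) (simp_all only: intensity that exp_ge_zero)
    finally show ?thesis by (simp only: ennreal_mult' exp_ge_zero)
  qed
  have Gg: "(\<integral>\<^sup>+x. ennreal (?g A x) \<partial>P) = ennreal (exp (- (m * real q) * (1 - exp (- \<gamma>))) - exp (- (m * real q)))"
    if "card A = j - 1" for A
  proof -
    \<comment> \<open>The count outside \<open>A\<close> therefore has mean \<open>m * q\<close>,
      the same exponent as in the bound for the partition function.\<close>
    have "card (- A) = q" using that j by (simp add: Compl_eq_Diff_UNIV card_Diff_subset)
    then show ?thesis
      using nn_integral_poisson_power_pos[OF poi facets, of "exp (- \<gamma>)" "- A"] by (simp add: intensity)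
  qed
  have g0: "exp (- (m * real q) * (1 - exp (- \<gamma>))) - exp (- (m * real q)) \<ge> 0"
    using m by (simp add: algebra_simps)
  have "(\<integral>\<^sup>+x. ennreal (exp (\<nu> * G j x) * G j x) \<partial>P) \<le>
      (\<integral>\<^sup>+x. ennreal (- 2 / \<nu> * ((\<Sum>I\<in>?II. ?f I x) + (\<Sum>A\<in>?AA. ?g A x))) \<partial>P)"
    using space_facet_process weighted_G_le[OF b _ _ j \<nu> L \<sigma>]
    unfolding \<gamma>_def by (intro nn_integral_mono ennreal_leI) blast
  also have "\<dots> = (\<integral>\<^sup>+x. ennreal (- 2 / \<nu>) * ((\<Sum>I\<in>?II. ennreal (?f I x)) + (\<Sum>A\<in>?AA. ennreal (?g A x))) \<partial>P)"
  proof (intro nn_integral_cong)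
    fix x
    have "ennreal (- 2 / \<nu> * ((\<Sum>I\<in>?II. ?f I x) + (\<Sum>A\<in>?AA. ?g A x))) =
        ennreal (- 2 / \<nu>) * (ennreal (\<Sum>I\<in>?II. ?f I x) + ennreal (\<Sum>A\<in>?AA. ?g A x))"
      unfolding ennreal_mult'[OF K] by (subst ennreal_plus) (auto intro!: sum_nonneg)
    also have "ennreal (\<Sum>I\<in>?II. ?f I x) = (\<Sum>I\<in>?II. ennreal (?f I x))"
      by (rule sum_ennreal[symmetric]) simp
    also have "ennreal (\<Sum>A\<in>?AA. ?g A x) = (\<Sum>A\<in>?AA. ennreal (?g A x))"
      by (rule sum_ennreal[symmetric]) simp
    finally show "ennreal (- 2 / \<nu> * ((\<Sum>I\<in>?II. ?f I x) + (\<Sum>A\<in>?AA. ?g A x))) =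
      ennreal (- 2 / \<nu>) * ((\<Sum>I\<in>?II. ennreal (?f I x)) + (\<Sum>A\<in>?AA. ennreal (?g A x)))" .
  qed
  also have "\<dots> = ennreal (- 2 / \<nu>) * ((\<Sum>I\<in>?II. \<integral>\<^sup>+x. ennreal (?f I x) \<partial>P) + (\<Sum>A\<in>?AA. \<integral>\<^sup>+x. ennreal (?g A x) \<partial>P))"
    by (simp only: nn_integral_cmult nn_integral_add nn_integral_sum mf mg borel_measurable_add borel_measurable_sum)
  also have "(\<Sum>I\<in>?II. \<integral>\<^sup>+x. ennreal (?f I x) \<partial>P) =
      ennreal (card ?II * (?E * exp (- (m * real (q + 1)) * (1 - exp (- \<sigma>)))))"
    by (subst sum.cong[OF refl F]) (simp_all add: ennreal_mult' ennreal_of_nat_eq_real_of_nat del: of_nat_add)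
  also have "(\<Sum>A\<in>?AA. \<integral>\<^sup>+x. ennreal (?g A x) \<partial>P) =
      ennreal (card ?AA * (exp (- (m * real q) * (1 - exp (- \<gamma>))) - exp (- (m * real q))))"
    by (subst sum.cong[OF refl Gg]) (simp_all add: ennreal_mult' ennreal_of_nat_eq_real_of_nat)
  finally show ?thesis
    using g0 unfolding ennreal_mult'[OF K] by (subst ennreal_plus) auto
qed

text \<open>Normalisation costs at most the factor \<open>exp (m * q)\<close>. It turns the
  difference of exponentials into \<open>exp (m * q * exp (- \<gamma>)) - 1\<close> and leaves a net
  decay in the term for rare orientations when \<open>L\<close> and \<open>\<sigma>\<close> are
  chosen well.\<close>

lemma gibbs_process_G_le:
  defines "\<gamma> \<equiv> - \<nu> / 2 * min_intersection CARD('d) j b * L"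
  shows "(\<integral>\<^sup>+x. ennreal (G j x) \<partial>gibbs_process \<nu> j P) \<le> ennreal (- 2 / \<nu> *
    (card {I :: 'd set. card I = q + 1} * exp (real (q + 1) * L * \<sigma> - m * real (q + 1) * (1 - exp (- \<sigma>)) + m * real q) +
     card {A :: 'd set. card A = j - 1} * (exp (m * real q * exp (- \<gamma>)) - 1)))"
proof -
  define Z where "Z = (\<integral>\<^sup>+x. ennreal (exp (\<nu> * G j x)) \<partial>P)"
  have "inverse Z \<le> inverse (ennreal (exp (- (m * q))))"
  proof (cases Z)
    case (real r)
    have "exp (- (m * q)) \<le> r"
      using partition_function_ge real unfolding Z_def[symmetric] by simp
    moreover from this have "r > 0" using exp_gt_zero less_le_trans by blast
    ultimately show ?thesis
      using real by (simp add: inverse_ennreal le_imp_inverse_le)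
  qed simp
  also have "\<dots> = ennreal (exp (m * q))"
    by (simp add: inverse_ennreal exp_minus)
  finally have Z: "inverse Z \<le> ennreal (exp (m * q))" .
  let ?B = "- 2 / \<nu> *
    (card {I :: 'd set. card I = q + 1} * (exp (real (q + 1) * L * \<sigma>) * exp (- (m * real (q + 1)) * (1 - exp (- \<sigma>)))) +
     card {A :: 'd set. card A = j - 1} * (exp (- (m * real q) * (1 - exp (- \<gamma>))) - exp (- (m * real q))))"
  have "(\<integral>\<^sup>+x. ennreal (G j x) \<partial>gibbs_process \<nu> j P) \<le>
      (\<integral>\<^sup>+x. ennreal (exp (\<nu> * G j x)) / Z * ennreal (G j x) \<partial>P)"
    unfolding gibbs_process_def Z_def[symmetric] by (rule nn_integral_density_le)
  also have "\<dots> = (\<integral>\<^sup>+x. inverse Z * ennreal (exp (\<nu> * G j x) * G j x) \<partial>P)"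
    by (simp only: divide_ennreal_def ennreal_mult'[OF exp_ge_zero] mult.assoc mult.left_commute)
  also have "\<dots> \<le> (\<integral>\<^sup>+x. ennreal (exp (m * q)) * ennreal (exp (\<nu> * G j x) * G j x) \<partial>P)"
    using Z by (intro nn_integral_mono mult_right_mono) auto
  also have "\<dots> = ennreal (exp (m * q)) * (\<integral>\<^sup>+x. ennreal (exp (\<nu> * G j x) * G j x) \<partial>P)"
    \<comment> \<open>The integrand contains \<open>G\<close>, so the version for arbitrary
      integrands is used.\<close>
    by (rule nn_integral_cmult_finite) (simp_all add: ennreal_eq_0_iff)
  also have "\<dots> \<le> ennreal (exp (m * q)) * ennreal ?B"
    using nn_integral_weighted_G_le unfolding \<gamma>_def by (rule mult_left_mono) simp
  also have "\<dots> = ennreal (exp (m * q) * ?B)"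
    by (rule ennreal_mult'[OF exp_ge_zero, symmetric])
  also have "exp (m * q) * ?B = - 2 / \<nu> *
    (card {I :: 'd set. card I = q + 1} * exp (real (q + 1) * L * \<sigma> - m * real (q + 1) * (1 - exp (- \<sigma>)) + m * real q) +
     card {A :: 'd set. card A = j - 1} * (exp (m * real q * exp (- \<gamma>)) - 1))"
  proof -
    have 1: "exp (real (q + 1) * L * \<sigma> - m * real (q + 1) * (1 - exp (- \<sigma>)) + m * real q) =
        exp (m * q) * (exp (real (q + 1) * L * \<sigma>) * exp (- (m * real (q + 1)) * (1 - exp (- \<sigma>))))"
      unfolding exp_add[symmetric] by (simp add: algebra_simps)
    have 2: "exp (m * real q * exp (- \<gamma>)) - 1 =
        exp (m * q) * (exp (- (m * real q) * (1 - exp (- \<gamma>))) - exp (- (m * real q)))"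
      unfolding right_diff_distrib exp_add[symmetric] by (simp add: algebra_simps)
    show ?thesis unfolding 1 2 by (simp only: distrib_left mult_ac)
  qed
  finally show ?thesis .
qed

end

text \<open>With \<open>m = a * \<tau>\<close>, the quantity \<open>m * exp (- (\<eta> * m))\<close>
  tends to 0, so the second exponential tends to 1.\<close>

lemma gibbs_bound_tendsto_0:
  fixes K c1 c2 q \<eta> \<tau> :: real
  assumes "\<tau> > 0" "\<eta> > 0"
  shows "((\<lambda>a. K * (c1 * exp (- (a * \<tau>) / 2) + c2 * (exp (a * \<tau> * q * exp (- (\<eta> * (a * \<tau>)))) - 1))) \<longlongrightarrow> 0) at_top"
proof -
  have m: "filterlim (\<lambda>a. a * \<tau>) at_top at_top"
    using assms by real_asymp
  have "((\<lambda>m. m * exp (- (\<eta> * m))) \<longlongrightarrow> 0) at_top"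
    using assms by real_asymp
  then have "((\<lambda>m. K * (c1 * exp (- m / 2) + c2 * (exp (q * (m * exp (- (\<eta> * m)))) - 1))) \<longlongrightarrow> K * (c1 * 0 + c2 * (exp (q * 0) - 1))) at_top"
    by (intro tendsto_intros) (auto, real_asymp)
  from filterlim_compose[OF this m] show ?thesis by (simp add: mult_ac)
qed

section \<open>Choice of the parameters and the limit\<close>

theorem theorem3:
  fixes b \<nu> :: real and chi :: "real ^ 'd::finite \<Rightarrow> real" and k :: nat
    and P :: "real \<Rightarrow> 'd facet set measure"
  assumes "CARD('d) \<ge> 2" and "k \<le> CARD('d) - 2" and "\<nu> < 0" and "b > 0"
    and "chi \<in> borel_measurable (restrict_space borel (cube b))"
    and "bounded (chi ` cube b)" and "\<And>z. z \<in> cube b \<Longrightarrow> 0 \<le> chi z"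
    and "(LINT z:cube b|lborel. chi z) > 0"
    and "\<And>a. a \<ge> 1 \<Longrightarrow> poisson_process (scale_measure (ennreal a) (facet_intensity b chi)) (P a)"
  shows "((\<lambda>a. \<integral>\<^sup>+ x. ennreal (G (CARD('d) - k) x) \<partial>gibbs_process \<nu> (CARD('d) - k) (P a)) \<longlongrightarrow> 0) at_top"
proof -
  define j where "j = CARD('d) - k"
  define q where "q = k + 1"
  have j: "2 \<le> j" "j + q = CARD('d) + 1" using assms(1,2) by (auto simp: j_def q_def)
  \<comment> \<open>The mean number of facets per orientation is \<open>a * \<tau>\<close>.\<close>
  define \<tau> where "\<tau> = (LINT z:cube b|lborel. chi z) / CARD('d)"
  have \<tau>: "\<tau> > 0" using assms(8) by (simp add: \<tau>_def)
  \<comment> \<open>Chosen so that \<open>(q + 1) * exp (- \<sigma>) = 1 / 4\<close>; then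
    \<open>\<epsilon>\<close> is chosen so that
    \<open>(q + 1) * \<epsilon> * \<sigma> = 1 / 4\<close>. Each of the two error terms in the
    exponent is thus \<open>m / 4\<close>.\<close>
  define \<sigma> where "\<sigma> = ln (4 * real (q + 1))"
  have \<sigma>: "\<sigma> > 0" by (simp add: \<sigma>_def)
  have e\<sigma>: "exp (- \<sigma>) = 1 / (4 * real (q + 1))" by (simp add: \<sigma>_def exp_minus inverse_eq_divide)
  define \<epsilon> where "\<epsilon> = 1 / (4 * real (q + 1) * \<sigma>)"
  have \<epsilon>: "\<epsilon> > 0" using \<sigma> by (simp add: \<epsilon>_def)
  have e\<epsilon>: "real (q + 1) * \<epsilon> * \<sigma> = 1 / 4" 
  proof -
    have "t * (1 / (4 * t * \<sigma>)) * \<sigma> = 1 / 4" if "t \<noteq> 0" for t :: real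
      using that \<sigma> by (simp add: field_simps)
    from this[of "real (q + 1)"] show ?thesis unfolding \<epsilon>_def by linarith
  qed
  define \<eta> where "\<eta> = - \<nu> / 2 * min_intersection CARD('d) j b * \<epsilon>"
  have \<eta>: "\<eta> > 0"
    using assms(3) \<epsilon> min_intersection_pos[OF assms(4)] unfolding \<eta>_def by (intro mult_pos_pos) auto
  define R where "R a = - 2 / \<nu> * (card {I :: 'd set. card I = q + 1} * exp (- (a * \<tau>) / 2) +
      card {A :: 'd set. card A = j - 1} * (exp (a * \<tau> * real q * exp (- (\<eta> * (a * \<tau>)))) - 1))" for a
  have le: "(\<integral>\<^sup>+ x. ennreal (G j x) \<partial>gibbs_process \<nu> j (P a)) \<le> ennreal (R a)" if a: "a \<ge> 1" for a
  proof -
    define m where "m = a * \<tau>"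
    have m: "m > 0" using a \<tau> by (simp add: m_def)
    have meas: "measure (scale_measure (ennreal a) (facet_intensity b chi)) (facet_space b I) = m * card I" for I
      using a measure_facet_space[OF assms(4,5,7,8)] by (simp add: m_def \<tau>_def)
    \<comment> \<open>The threshold is \<open>L = \<epsilon> * m\<close>, a small fraction of the
      mean, so the decay rate \<open>\<gamma>\<close> grows linearly in \<open>m\<close>.\<close>
    have "- \<nu> / 2 * min_intersection CARD('d) j b * (\<epsilon> * m) = \<eta> * m" by (simp add: \<eta>_def)
    \<comment> \<open>The leading terms \<open>- (q + 1) * m + q * m\<close> give
      \<open>- m\<close>, and the two errors return only half of it.\<close>
    moreover have "real (q + 1) * (\<epsilon> * m) * \<sigma> - m * real (q + 1) * (1 - exp (- \<sigma>)) + m * real q = - m / 2"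
    proof -
      have "real (q + 1) * (\<epsilon> * m) * \<sigma> = m * (real (q + 1) * \<epsilon> * \<sigma>)" by simp
      also have "\<dots> = m / 4" unfolding e\<epsilon> by simp
      finally have 1: "real (q + 1) * (\<epsilon> * m) * \<sigma> = m / 4" .
      have 2: "m * real (q + 1) * (1 - exp (- \<sigma>)) = m * real (q + 1) - m / 4"
        unfolding e\<sigma> by (simp add: field_simps)
      show ?thesis unfolding 1 2 by (simp add: algebra_simps)
    qed
    ultimately show ?thesis
      using gibbs_process_G_le[OF assms(4) _ assms(3) _ \<sigma> j assms(9)[OF a] _ _ meas, of "\<epsilon> * m"]
        m \<epsilon> space_facet_intensity[OF assms(4,5,7,8)] facet_space_sets[OF assms(4,5,7,8)]
      unfolding R_def m_def[symmetric] by (simp add: space_scale_measure)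
  qed
  have "(R \<longlongrightarrow> 0) at_top"
    unfolding R_def by (rule gibbs_bound_tendsto_0[OF \<tau> \<eta>])
  then have "((\<lambda>a. ennreal (R a)) \<longlongrightarrow> 0) at_top"
    using tendsto_ennrealI by fastforce
  then have "((\<lambda>a. \<integral>\<^sup>+ x. ennreal (G j x) \<partial>gibbs_process \<nu> j (P a)) \<longlongrightarrow> 0) at_top"
    by (rule tendsto_sandwich[rotated 3, OF _ _ _ tendsto_const])
      (auto intro!: eventually_at_top_linorderI[of 1] le)
  then show ?thesis by (simp add: j_def)
qed

end
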